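(* Let $B$ be the ordinal sum of copulas $\{B_k\mid k=1,\ldots,n\}$ with respect to a finite family $\{(a_k,b_k)\mid k=1,\ldots,n\}$ of disjoint open subintervals of $[0,1]$. Then Chatterjee's xi of $B$ is $$\xi(B)=1-\sum_{k=1}^n(b_k-a_k)^2(1-\xi(B_k)).$$
   Context: Let $\mathbb{I}=[0,1]$. A (bivariate) copula is a function $C:\mathbb{I}^2\to\mathbb{I}$ with $C(0,v)=C(u,0)=0$, $C(u,1)=u$, $C(1,v)=v$ for all $u,v\in\mathbb{I}$, and $C(u_2,v_2)-C(u_2,v_1)-C(u_1,v_2)+C(u_1,v_1)\ge 0$ whenever $u_1\le u_2$, $v_1\le v_2$ in $\mathbb{I}$. Every copula is increasing in each variable, hence partially differentiable almost everywhere; $\partial_1 C$ denotes the partial derivative with respect to the first variable. Given disjoint open subintervals $(a_k,b_k)$ of $\mathbb{I}$ and copulas $B_k$, $k=1,\ldots,n$, the ordinal sum $B$ of $\{B_k\}$ with respect to $\{(a_k,b_k)\}$ is the copula defined by $B(u,v)=a_k+(b_k-a_k)B_k\big(\frac{u-a_k}{b_k-a_k},\frac{v-a_k}{b_k-a_k}\big)$ if $(u,v)\in[a_k,b_k]^2$ for some $k$, and $B(u,v)=\min\{u,v\}$ otherwise. Chatterjee's xi of a copula $C$ is $\xi(C)=6\int_{\mathbb{I}^2}(\partial_1 C(u,v))^2\,du\,dv-2$. *)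

theory Defs
  imports "HOL-Analysis.Analysis"
begin

text \<open>
  Functions on the unit square are rendered as total functions on the reals; all notions below
  only refer to their values on the unit square.
\<close>

definition copula :: "(real \<Rightarrow> real \<Rightarrow> real) \<Rightarrow> bool" where
  "copula C \<longleftrightarrow>
     (\<forall>u\<in>{0..1}. \<forall>v\<in>{0..1}. C u v \<in> {0..1}) \<and>
     (\<forall>v\<in>{0..1}. C 0 v = 0) \<and> (\<forall>u\<in>{0..1}. C u 0 = 0) \<and>
     (\<forall>u\<in>{0..1}. C u 1 = u) \<and> (\<forall>v\<in>{0..1}. C 1 v = v) \<and>
     (\<forall>u1\<in>{0..1}. \<forall>u2\<in>{0..1}. \<forall>v1\<in>{0..1}. \<forall>v2\<in>{0..1}. u1 \<le> u2 \<longrightarrow> v1 \<le> v2 \<longrightarrow>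
        C u2 v2 - C u2 v1 - C u1 v2 + C u1 v1 \<ge> 0)"

text \<open>
  The derivative is taken relative to the unit interval (one-sided at the endpoints). Where it
  does not exist, which for a copula happens only on a null set, the value is unspecified.
\<close>

definition partial1 :: "(real \<Rightarrow> real \<Rightarrow> real) \<Rightarrow> real \<Rightarrow> real \<Rightarrow> real" where
  "partial1 C u v = vector_derivative (\<lambda>s. C s v) (at u within {0..1})"

definition xi :: "(real \<Rightarrow> real \<Rightarrow> real) \<Rightarrow> real" where
  "xi C = 6 * set_lebesgue_integral lborel ({0..1} \<times> {0..1}) (\<lambda>(u, v). (partial1 C u v)\<^sup>2) - 2"

text \<open>
  Squares of adjacent intervals may share a corner, where both formulas give the same value; the
  \<open>LEAST\<close> only makes the choice definite. See \<open>ordinal_sum_inside\<close> below.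
\<close>

definition ordinal_sum ::
  "nat \<Rightarrow> (nat \<Rightarrow> real) \<Rightarrow> (nat \<Rightarrow> real) \<Rightarrow> (nat \<Rightarrow> real \<Rightarrow> real \<Rightarrow> real) \<Rightarrow> real \<Rightarrow> real \<Rightarrow> real"
where
  "ordinal_sum n a b Bs u v =
     (if \<exists>k\<in>{1..n}. u \<in> {a k..b k} \<and> v \<in> {a k..b k}
      then let k = (LEAST k. k \<in> {1..n} \<and> u \<in> {a k..b k} \<and> v \<in> {a k..b k})
           in a k + (b k - a k) * Bs k ((u - a k) / (b k - a k)) ((v - a k) / (b k - a k))
      else min u v)"

lemma ordinal_sum_inside:
  fixes a b :: "nat \<Rightarrow> real"
  assumes lt: "\<And>k. k \<in> {1..n} \<Longrightarrow> a k < b k"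
    and disj: "disjoint_family_on (\<lambda>k. {a k<..<b k}) {1..n}"
    and cop: "\<And>k. k \<in> {1..n} \<Longrightarrow> copula (Bs k)"
    and k: "k \<in> {1..n}" and u: "u \<in> {a k..b k}" and v: "v \<in> {a k..b k}"
  shows "ordinal_sum n a b Bs u v =
           a k + (b k - a k) * Bs k ((u - a k) / (b k - a k)) ((v - a k) / (b k - a k))"
proof -
  let ?P = "\<lambda>j. j \<in> {1..n} \<and> u \<in> {a j..b j} \<and> v \<in> {a j..b j}"
  let ?f = "\<lambda>j. a j + (b j - a j) * Bs j ((u - a j) / (b j - a j)) ((v - a j) / (b j - a j))"
  define l where "l = (LEAST j. ?P j)"
  have Pk: "?P k" using k u v by blast
  have Pl: "?P l" unfolding l_def by (rule LeastI[of ?P, OF Pk])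
  have "ordinal_sum n a b Bs u v = ?f l"
    unfolding ordinal_sum_def Let_def l_def[symmetric] using Pk by auto
  also have "?f l = ?f k"
  proof (cases "l = k")
    case False
    have corner: "?f i = b i \<and> ?f j = a j"
      if ij: "?P i" "?P j" "b i \<le> a j" for i j
    proof -
      have uv: "u = b i" "v = b i" "u = a j" "v = a j" using ij by auto
      have "Bs i 1 1 = 1" "Bs j 0 0 = 0" using cop[of i] cop[of j] ij by (auto simp: copula_def)
      moreover have "b i - a i \<noteq> 0" using lt[of i] ij by auto
      ultimately have "?f i = b i" "?f j = a j" 
        by (simp_all add: uv(1,2), simp add: uv(3,4)[unfolded uv(1,2)])
      then show ?thesis by blast
    qed
    have "{a l<..<b l} \<inter> {a k<..<b k} = {}"
      using disj Pl Pk False by (auto simp: disjoint_family_on_def)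
    then have "\<not> max (a l) (a k) < min (b l) (b k)"
      using dense[of "max (a l) (a k)" "min (b l) (b k)"] by fastforce
    then have "b l \<le> a k \<or> b k \<le> a l" using lt[of l] lt[of k] Pl Pk by auto
    then show ?thesis
    proof
      assume le: "b l \<le> a k"
      then have "b l = a k" using Pl Pk by auto
      then show ?thesis using corner[OF Pl Pk le] by linarith
    next
      assume le: "b k \<le> a l"
      then have "b k = a l" using Pl Pk by auto
      then show ?thesis using corner[OF Pk Pl le] by linarith
    qed
  qed simp
  finally show ?thesis .
qed

end

theory Submission
  imports Defs
begin

text \<open>
  Let \<open>D = {0 \<le> u < v \<le> 1}\<close>, whose indicator is almost everywhere \<open>(\<partial>\<^sub>1 M)\<^sup>2\<close> for the copula
  \<open>M = min\<close>, and let \<open>T\<^sub>k\<close> be the affine map that takes \<open>[a\<^sub>k, b\<^sub>k]\<^sup>2\<close> to the unit square. Extending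
  functions on the unit square by zero, one has
  \<open>(\<partial>\<^sub>1 B)\<^sup>2 = 1\<^sub>D + (\<Sum>k. ((\<partial>\<^sub>1 B\<^sub>k)\<^sup>2 - 1\<^sub>D) \<circ> T\<^sub>k)\<close> off the diagonal and finitely many vertical
  lines. Integrating, with \<open>D\<close> of area \<open>1/2\<close> and \<open>T\<^sub>k\<close> of Jacobian \<open>(b\<^sub>k - a\<^sub>k)\<^sup>-\<^sup>2\<close>, gives the formula.
  Borel measurability of \<open>\<partial>\<^sub>1 C\<close> for continuous \<open>C\<close> comes from testing the limit of the difference
  quotients along one fixed sequence against all rational points.
\<close>

section \<open>Integration tools: affine substitution, null hyperplanes, area of the
  triangle\<close>

text \<open>The image of \<open>lborel\<close> under \<open>x \<mapsto> t + c x\<close>, weighted by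
  \<open>c ^ DIM('a)\<close>, is \<open>lborel\<close> again, and this map is inverse to
  \<open>(x - t) /\<^sub>R c\<close>.\<close>

lemma affine_change_of_variables_lborel:
  fixes f :: "'a::euclidean_space \<Rightarrow> real"
  assumes f: "integrable lborel f" and c: "0 < c"
  shows "has_bochner_integral lborel (\<lambda>x. f ((x - t) /\<^sub>R c)) (c ^ DIM('a) * integral\<^sup>L lborel f)"
proof -
  have [measurable]: "f \<in> borel_measurable borel"
    using borel_measurable_integrable[OF f] by simp
  have inv: "(t + c *\<^sub>R x - t) /\<^sub>R c = x" for x :: 'a
    using c by simp
  have "has_bochner_integral lborel (\<lambda>x. c ^ DIM('a) *\<^sub>R f x) (c ^ DIM('a) *\<^sub>R integral\<^sup>L lborel f)"
    using f by (intro has_bochner_integral_scaleR_right has_bochner_integral_integrable)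
  then have "has_bochner_integral
      (density (distr lborel borel (\<lambda>x. t + c *\<^sub>R x)) (\<lambda>_. ennreal (c ^ DIM('a))))
      (\<lambda>x. f ((x - t) /\<^sub>R c)) (c ^ DIM('a) * integral\<^sup>L lborel f)"
    using c by (intro has_bochner_integral_density has_bochner_integral_distr) (simp_all add: inv)
  then show ?thesis
    using lborel_affine[of c t] c by (simp add: ennreal_power)
qed

text \<open>\<open>negligible_hyperplane\<close> gives a null set of the completed measure;
  closedness makes it Borel, hence null for \<open>lborel\<close>.\<close>

lemma AE_lborel_hyperplane:
  fixes a :: "'a::euclidean_space"
  assumes "a \<noteq> 0"
  shows "AE x in lborel. a \<bullet> x \<noteq> b"
proof -
  have "closed {x. a \<bullet> x = b}" by (rule closed_hyperplane)
  moreover have "{x. a \<bullet> x = b} \<in> null_sets lebesgue"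
    using negligible_hyperplane[of a b] assms by (simp add: negligible_iff_null_sets)
  ultimately have "{x. a \<bullet> x = b} \<in> null_sets lborel"
    by (simp add: null_sets_completion_iff)
  from AE_not_in[OF this] show ?thesis by simp
qed

definition triangle :: "(real \<times> real) set" where
  "triangle = {p. 0 \<le> fst p \<and> fst p < snd p \<and> snd p \<le> 1}"

lemma triangle_sets [measurable]: "triangle \<in> sets borel"
proof -
  have "{p \<in> space (borel \<Otimes>\<^sub>M borel :: (real \<times> real) measure).
      0 \<le> fst p \<and> fst p < snd p \<and> snd p \<le> 1} \<in> sets (borel \<Otimes>\<^sub>M borel)"
    by measurable
  then show ?thesis unfolding triangle_def borel_prod by simp
qed

text \<open>Fubini: for \<open>u\<close> in \<open>[0, 1]\<close> the section is
  \<open>{u<..1}\<close>, of length \<open>1 - u\<close>.\<close>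

lemma has_bochner_integral_triangle:
  "has_bochner_integral lborel (indicator triangle :: real \<times> real \<Rightarrow> real) (1 / 2)"
proof -
  have int: "integrable lborel (indicator triangle :: real \<times> real \<Rightarrow> real)"
  proof (rule integrable_real_indicator)
    have "emeasure lborel triangle \<le> emeasure lborel (cbox (0, 0) (1, 1) :: (real \<times> real) set)"
      by (rule emeasure_mono) (auto simp: triangle_def)
    also have "\<dots> < \<infinity>" using emeasure_lborel_cbox_finite by blast
    finally show "emeasure lborel triangle < \<infinity>" .
  qed simp
  have "integral\<^sup>L lborel (indicator triangle :: real \<times> real \<Rightarrow> real)
      = (\<integral>u. \<integral>v. indicator triangle (u, v) \<partial>lborel \<partial>lborel)"
    using lborel_pair.integral_fst'[of "indicator triangle :: real \<times> real \<Rightarrow> real"] int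
    by (simp only: lborel_prod)
  also have "\<dots> = (\<integral>u. (1 - u) * indicator {0..1} u \<partial>lborel)"
  proof (rule Bochner_Integration.integral_cong[OF refl])
    fix u :: real
    have "(indicator triangle (u, v) :: real) = indicator (if 0 \<le> u then {u<..1} else {}) v" for v
      by (auto simp: triangle_def indicator_def)
    then have "(\<integral>v. indicator triangle (u, v) \<partial>lborel)
        = measure lborel (if 0 \<le> u then {u<..1} else {})"
      by simp
    then show "(\<integral>v. indicator triangle (u, v) \<partial>lborel) = (1 - u) * indicator {0..1} u"
      by (simp add: indicator_def)
  qed
  also have "\<dots> = (1 - 1\<^sup>2 / 2) - (0 - 0\<^sup>2 / 2)"
    by (rule integral_FTC_Icc_real[where F = "\<lambda>u. u - u\<^sup>2 / 2"])
       (auto intro!: derivative_eq_intros continuous_intros)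
  finally show ?thesis using int by (simp add: has_bochner_integral_iff)
qed

section \<open>Measurability of the first partial derivative\<close>

text \<open>For fixed \<open>n\<close> and \<open>m\<close> the estimate compares continuous
  functions of the parameter \<open>x\<close> in \<open>c x\<close>, so it fails on an open set of
  parameters, which is empty if it has no rational point. Only countable quantifiers remain, which
  makes differentiability a measurable condition. Since \<open>c\<close> maps the line onto
  \<open>S\<close>, rational parameters reach a dense part of \<open>S\<close>.\<close>

lemma has_vector_derivative_within_iff_rat:
  fixes f :: "real \<Rightarrow> real" and c :: "real \<Rightarrow> real"
  assumes cf: "continuous_on S f" and cc: "continuous_on UNIV c" and im: "range c = S"
  shows "(f has_vector_derivative L) (at u within S) \<longleftrightarrow>
    (\<forall>n::nat. \<exists>m::nat. \<forall>q::rat. \<bar>c (of_rat q) - u\<bar> < 1 / (Suc m) \<longrightarrow>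
      \<bar>f (c (of_rat q)) - f u - (c (of_rat q) - u) * L\<bar> \<le> \<bar>c (of_rat q) - u\<bar> / (Suc n))"
    (is "_ \<longleftrightarrow> ?R")
proof
  assume "(f has_vector_derivative L) (at u within S)"
  then have alt: "\<forall>e>0. \<exists>d>0. \<forall>y\<in>S. \<bar>y - u\<bar> < d \<longrightarrow>
      \<bar>f y - f u - (y - u) * L\<bar> \<le> e * \<bar>y - u\<bar>"
    unfolding has_vector_derivative_def has_derivative_within_alt by simp
  show ?R
  proof
    fix n :: nat
    obtain d where d: "d > 0" "\<And>y. y \<in> S \<Longrightarrow> \<bar>y - u\<bar> < d \<Longrightarrow>
        \<bar>f y - f u - (y - u) * L\<bar> \<le> 1 / (Suc n) * \<bar>y - u\<bar>"
      using alt[rule_format, of "1 / Suc n"] by auto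
    obtain m :: nat where "1 / (Suc m) < d" using nat_approx_posE[OF d(1)] by metis
    then show "\<exists>m::nat. \<forall>q::rat. \<bar>c (of_rat q) - u\<bar> < 1 / (Suc m) \<longrightarrow>
      \<bar>f (c (of_rat q)) - f u - (c (of_rat q) - u) * L\<bar> \<le> \<bar>c (of_rat q) - u\<bar> / (Suc n)"
      using d(2) im by (intro exI[of _ m]) fastforce
  qed
next
  assume R: ?R
  have cfc: "continuous_on UNIV (\<lambda>x. f (c x))"
    using continuous_on_compose2[OF cf cc] im by auto
  have "\<exists>d>0. \<forall>y\<in>S. \<bar>y - u\<bar> < d \<longrightarrow> \<bar>f y - f u - (y - u) * L\<bar> \<le> e * \<bar>y - u\<bar>"
    if "e > 0" for e
  proof -
    obtain n :: nat where n: "1 / (Suc n) < e" using nat_approx_posE[OF \<open>e > 0\<close>] by metis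
    obtain m :: nat where m: "\<And>q::rat. \<bar>c (of_rat q) - u\<bar> < 1 / (Suc m) \<Longrightarrow>
      \<bar>f (c (of_rat q)) - f u - (c (of_rat q) - u) * L\<bar> \<le> \<bar>c (of_rat q) - u\<bar> / (Suc n)"
      using R by blast
    define A where "A = {x. \<bar>c x - u\<bar> < 1 / (Suc m)} \<inter>
        {x. \<bar>c x - u\<bar> / (Suc n) < \<bar>f (c x) - f u - (c x - u) * L\<bar>}"
    have "open A"
      unfolding A_def
      by (intro open_Int open_Collect_less continuous_intros cc cfc) auto
    moreover have "\<rat> \<inter> A = {}"
      using m by (force simp: A_def Rats_def)
    ultimately have "A = {}"
      using open_Int_closure_eq_empty[of A \<rat>] by (simp add: Rats_closure_real Int_commute)
    then have *: "\<bar>f (c x) - f u - (c x - u) * L\<bar> \<le> \<bar>c x - u\<bar> / (Suc n)"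
      if "\<bar>c x - u\<bar> < 1 / (Suc m)" for x
      using that unfolding A_def by (metis (mono_tags, lifting) IntI empty_iff linorder_not_less mem_Collect_eq)
    have "\<bar>f y - f u - (y - u) * L\<bar> \<le> e * \<bar>y - u\<bar>" if y: "y \<in> S" "\<bar>y - u\<bar> < 1 / (Suc m)" for y
    proof -
      obtain x where "y = c x" using y im by auto
      then have "\<bar>f y - f u - (y - u) * L\<bar> \<le> 1 / (Suc n) * \<bar>y - u\<bar>" using * y by simp
      also have "\<dots> \<le> e * \<bar>y - u\<bar>" using n by (intro mult_right_mono) auto
      finally show ?thesis .
    qed
    then show ?thesis by (intro exI[of _ "1 / (Suc m)"]) auto
  qed
  then show "(f has_vector_derivative L) (at u within S)"
    unfolding has_vector_derivative_def has_derivative_within_alt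
    by (auto intro: bounded_linear_intros)
qed

text \<open>Serves both to parametrize the unit interval by the line and to extend functions
  continuously from the unit square to the plane.\<close>

definition clip :: "real \<Rightarrow> real" where
  "clip x = max 0 (min 1 x)"

lemma clip_in [simp]: "clip x \<in> {0..1}" "0 \<le> clip x" "clip x \<le> 1"
  by (auto simp: clip_def)

lemma clip_id [simp]: "x \<in> {0..1} \<Longrightarrow> clip x = x"
  by (auto simp: clip_def)

lemma clip_outside: "x \<le> 0 \<Longrightarrow> clip x = 0" "1 \<le> x \<Longrightarrow> clip x = 1"
  by (auto simp: clip_def)

lemma continuous_on_clip [continuous_intros]:
  "continuous_on S f \<Longrightarrow> continuous_on S (\<lambda>x. clip (f x))"
  unfolding clip_def by (intro continuous_intros)

lemma range_clip: "range clip = {0..1}"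
proof
  show "{0..1} \<subseteq> range clip"
    using clip_id by (metis rangeI subsetI)
qed auto

text \<open>Steps go towards the farther endpoint; being nonzero and at most 1/2, they never leave
  the unit interval. The explicit formula keeps the sequence measurable in \<open>u\<close>.\<close>

definition approach :: "real \<Rightarrow> nat \<Rightarrow> real" where
  "approach u n = (if u < 1 / 2 then u + 1 / 2 * inverse (Suc n) else u - 1 / 2 * inverse (Suc n))"

lemma approach_neq: "approach u n \<noteq> u"
  by (auto simp: approach_def)

lemma approach_in: "u \<in> {0..1} \<Longrightarrow> approach u n \<in> {0..1}"
proof -
  assume u: "u \<in> {0..1}"
  define d where "d = inverse (real (Suc n))"
  have "d \<le> 1" "0 < d"
    by (auto simp: d_def field_simps)
  with u show ?thesis unfolding approach_def d_def[symmetric] by auto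
qed

lemma approach_tendsto: "approach u \<longlonglongrightarrow> u"
proof -
  have "(\<lambda>n. u + 1 / 2 * inverse (real (Suc n))) \<longlonglongrightarrow> u + 1 / 2 * 0"
    "(\<lambda>n. u - 1 / 2 * inverse (real (Suc n))) \<longlonglongrightarrow> u - 1 / 2 * 0"
    by (intro tendsto_intros LIMSEQ_inverse_real_of_nat)+
  then show ?thesis
    unfolding approach_def[abs_def] by (cases "u < 1 / 2") (simp_all del: of_nat_Suc)
qed

lemma measurable_approach [measurable]: "(\<lambda>u. approach u n) \<in> borel_measurable borel"
  unfolding approach_def by measurable

lemma has_vector_derivative_approach:
  fixes f :: "real \<Rightarrow> real"
  assumes f: "(f has_vector_derivative L) (at u within {0..1})" and u: "u \<in> {0..1}"
  shows "(\<lambda>n. (f (approach u n) - f u) / (approach u n - u)) \<longlonglongrightarrow> L"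
proof -
  have "((\<lambda>y. (f y - f u) / (y - u)) \<longlongrightarrow> L) (at u within {0..1})"
    using f by (simp add: has_real_derivative_iff_has_vector_derivative[symmetric]
        has_field_derivative_iff)
  moreover have "filterlim (approach u) (at u within {0..1}) sequentially"
    using approach_tendsto approach_in[OF u] approach_neq
    by (auto simp: filterlim_at intro!: always_eventually)
  ultimately show ?thesis by (rule filterlim_compose)
qed

text \<open>
  The junk value of \<^const>\<open>vector_derivative\<close> is one constant, the same for all functions and
  points. Hence \<^const>\<open>partial1\<close> commutes with affine rescaling even where the derivative does not
  exist, and differentiability almost everywhere is not an issue.
\<close>

lemma vector_derivative_undefined:
  assumes "\<And>L. \<not> (f has_vector_derivative L) F"
  shows "vector_derivative f F = (SOME L. False)"
  using assms by (simp add: vector_derivative_def)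

lemma partial1_eqI:
  assumes "u \<in> {0..1}" "((\<lambda>s. C s v) has_vector_derivative L) (at u within {0..1})"
  shows "partial1 C u v = L"
  unfolding partial1_def
  by (rule vector_derivative_within_closed_interval) (use assms in auto)

lemma partial1_cong:
  assumes "\<And>s. s \<in> {0..1} \<Longrightarrow> C s v = D s v" "u \<in> {0..1}"
  shows "partial1 C u v = partial1 D u v"
  unfolding partial1_def using assms by (intro vector_derivative_cong_eq) auto

text \<open>Only the values of \<open>C\<close> on the square are controlled, so difference
  quotients are formed with the continuous extension \<open>F\<close>. On the square,
  \<open>partial1\<close> equals a measurable candidate \<open>L\<close> where the test
  \<open>P\<close> succeeds and the constant junk value elsewhere.\<close>

lemma partial1_measurable:
  fixes C F :: "real \<Rightarrow> real \<Rightarrow> real"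
  assumes cont: "continuous_on UNIV (\<lambda>p. F (fst p) (snd p))"
    and eq: "\<And>u v. u \<in> {0..1} \<Longrightarrow> v \<in> {0..1} \<Longrightarrow> C u v = F u v"
  shows "(\<lambda>p. indicator ({0..1} \<times> {0..1}) p * (partial1 C (fst p) (snd p))\<^sup>2) \<in> borel_measurable borel"
proof -
  let ?M = "borel \<Otimes>\<^sub>M borel :: (real \<times> real) measure"
  have [measurable]: "(\<lambda>(u, v). F u v) \<in> borel_measurable ?M"
    using borel_measurable_continuous_onI[OF cont] by (simp add: borel_prod case_prod_unfold)
  \<comment> \<open>On the square, an existing derivative must be this limit; where the quotients
    diverge, \<open>lim\<close> still has some value, so \<open>P\<close> below checks the
    candidate.\<close>
  define L where "L p = lim (\<lambda>n. (F (approach (fst p) n) (snd p) - F (fst p) (snd p)) /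
      (approach (fst p) n - fst p))" for p
  have [measurable]: "L \<in> borel_measurable ?M"
    unfolding L_def by measurable
  have [measurable]: "clip \<in> borel_measurable borel"
    unfolding clip_def by measurable
  define P where "P p \<longleftrightarrow> (\<forall>n::nat. \<exists>m::nat. \<forall>q::rat.
      \<bar>clip (of_rat q) - fst p\<bar> < 1 / (Suc m) \<longrightarrow>
      \<bar>F (clip (of_rat q)) (snd p) - F (fst p) (snd p) - (clip (of_rat q) - fst p) * L p\<bar>
        \<le> \<bar>clip (of_rat q) - fst p\<bar> / (Suc n))" for p
  have [measurable]: "Measurable.pred ?M P"
    unfolding P_def by measurable
  have "partial1 C (fst p) (snd p) = (if P p then L p else (SOME L. False))"
    if p: "p \<in> {0..1} \<times> {0..1}" for p
  proof -
    obtain u v where [simp]: "p = (u, v)" and uv: "u \<in> {0..1}" "v \<in> {0..1}" using p by auto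
    have "continuous_on UNIV (\<lambda>s. F s v)"
      using continuous_on_compose2[OF cont, of UNIV "\<lambda>s. (s, v)"]
      by (simp add: continuous_on_Pair continuous_on_id continuous_on_const)
    then have P: "P p \<longleftrightarrow> ((\<lambda>s. F s v) has_vector_derivative L p) (at u within {0..1})"
      by (subst has_vector_derivative_within_iff_rat[of _ _ clip])
         (auto simp: P_def range_clip intro: continuous_on_subset continuous_on_clip continuous_on_id)
    have "partial1 C u v = partial1 F u v"
      using eq uv by (intro partial1_cong) auto
    moreover have "partial1 F u v = (if P p then L p else (SOME L. False))"
    proof (cases "P p")
      case True
      then show ?thesis using partial1_eqI[of u F v "L p"] P uv by simp
    next
      case False
      \<comment> \<open>A derivative \<open>l\<close> would be the limit along
        \<open>approach\<close>, hence equal to \<open>L p\<close>, and \<open>P p\<close> would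
        hold.\<close>
      have "\<not> ((\<lambda>s. F s v) has_vector_derivative l) (at u within {0..1})" for l
      proof
        assume l: "((\<lambda>s. F s v) has_vector_derivative l) (at u within {0..1})"
        then have "L p = l"
          using limI[OF has_vector_derivative_approach[OF l uv(1)]] by (simp add: L_def)
        with l False P show False by simp
      qed
      with False show ?thesis by (simp add: partial1_def vector_derivative_undefined)
    qed
    ultimately show ?thesis by simp
  qed
  then have "(\<lambda>p. indicator ({0..1} \<times> {0..1}) p * (partial1 C (fst p) (snd p))\<^sup>2) =
      (\<lambda>p. indicator ({0..1} \<times> {0..1}) p * (if P p then L p else (SOME L. False))\<^sup>2)"
    by (auto simp: fun_eq_iff indicator_def)
  moreover have "\<dots> \<in> borel_measurable ?M"
    by measurable
  ultimately show ?thesis by (simp add: borel_prod)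
qed

section \<open>Lipschitz bounds for copulas and integrability\<close>

text \<open>For \<open>x \<le> y\<close>, the rectangle \<open>[x, y] \<times> [v, 1]\<close> bounds
  the increment above by \<open>y - x\<close>, and \<open>[x, y] \<times> [0, v]\<close> shows that
  it is nonnegative.\<close>

lemma copula_lipschitz_fst:
  assumes C: "copula C" and "u1 \<in> {0..1}" "u2 \<in> {0..1}" "v \<in> {0..1}"
  shows "\<bar>C u2 v - C u1 v\<bar> \<le> \<bar>u2 - u1\<bar>"
proof -
  have *: "\<bar>C y v - C x v\<bar> \<le> \<bar>y - x\<bar>" if "x \<in> {0..1}" "y \<in> {0..1}" "x \<le> y" for x y
  proof -
    have rect: "\<And>v1 v2. v1 \<in> {0..1} \<Longrightarrow> v2 \<in> {0..1} \<Longrightarrow> v1 \<le> v2 \<Longrightarrow>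
        C y v2 - C y v1 - C x v2 + C x v1 \<ge> 0"
      using C that unfolding copula_def by blast
    have "C y 1 = y" "C x 1 = x" "C y 0 = 0" "C x 0 = 0"
      using C that by (auto simp: copula_def)
    then show ?thesis using rect[of v 1] rect[of 0 v] assms by auto
  qed
  show ?thesis using *[of u1 u2] *[of u2 u1] assms by (cases "u1 \<le> u2") auto
qed

lemma copula_transpose: "copula C \<Longrightarrow> copula (\<lambda>u v. C v u)"
  unfolding copula_def by (auto simp: algebra_simps) 

lemma copula_lipschitz_snd:
  assumes "copula C" "u \<in> {0..1}" "v1 \<in> {0..1}" "v2 \<in> {0..1}"
  shows "\<bar>C u v2 - C u v1\<bar> \<le> \<bar>v2 - v1\<bar>"
  using copula_lipschitz_fst[OF copula_transpose[OF assms(1)] assms(3,4,2)] .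

lemma copula_continuous_on:
  assumes C: "copula C"
  shows "continuous_on ({0..1} \<times> {0..1}) (\<lambda>p. C (fst p) (snd p))"
  unfolding continuous_on_iff
proof (intro ballI allI impI)
  fix p :: "real \<times> real" and e :: real
  assume p: "p \<in> {0..1} \<times> {0..1}" and e: "0 < e"
  have "dist (C (fst q) (snd q)) (C (fst p) (snd p)) < e"
    if q: "q \<in> {0..1} \<times> {0..1}" "dist q p < e / 2" for q
  proof -
    have "\<bar>fst q - fst p\<bar> < e / 2" "\<bar>snd q - snd p\<bar> < e / 2"
      using q(2) dist_fst_le[of q p] dist_snd_le[of q p] by (auto simp: dist_real_def)
    moreover have "\<bar>C (fst q) (snd q) - C (fst p) (snd q)\<bar> \<le> \<bar>fst q - fst p\<bar>"
      "\<bar>C (fst p) (snd q) - C (fst p) (snd p)\<bar> \<le> \<bar>snd q - snd p\<bar>"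
      using p q by (auto intro!: copula_lipschitz_fst[OF C] copula_lipschitz_snd[OF C])
    ultimately show ?thesis unfolding dist_real_def by linarith
  qed
  then show "\<exists>d>0. \<forall>q\<in>{0..1} \<times> {0..1}. dist q p < d \<longrightarrow>
      dist (C (fst q) (snd q)) (C (fst p) (snd p)) < e"
    using e by (intro exI[of _ "e / 2"]) auto
qed

lemma copula_clip_continuous [continuous_intros]:
  assumes "copula C" "continuous_on S f" "continuous_on S g"
  shows "continuous_on S (\<lambda>x. C (clip (f x)) (clip (g x)))"
  using continuous_on_compose2[OF copula_continuous_on[OF assms(1)],
      of S "\<lambda>x. (clip (f x), clip (g x))"] assms(2,3)
  by (simp add: continuous_on_Pair continuous_on_clip image_subset_iff)

text \<open>The Lipschitz bound limits difference quotients to 1 in absolute value; the other entry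
  of the maximum covers the junk value where no derivative exists.\<close>

lemma copula_partial1_bound:
  assumes C: "copula C" and uv: "u \<in> {0..1}" "v \<in> {0..1}"
  shows "\<bar>partial1 C u v\<bar> \<le> max 1 \<bar>SOME L. False\<bar>"
proof (cases "\<exists>L. ((\<lambda>s. C s v) has_vector_derivative L) (at u within {0..1})")
  case True
  then obtain L where L: "((\<lambda>s. C s v) has_vector_derivative L) (at u within {0..1})" by blast
  have "\<bar>(C (approach u n) v - C u v) / (approach u n - u)\<bar> \<le> 1" for n
    using copula_lipschitz_fst[OF C uv(1) approach_in[OF uv(1)] uv(2), of n] approach_neq[of u n]
    by (simp add: field_simps)
  then have "\<bar>L\<bar> \<le> 1"
    using LIMSEQ_le_const2[OF tendsto_rabs[OF has_vector_derivative_approach[OF L uv(1)]]] by blast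
  then show ?thesis using partial1_eqI[where C = C, OF uv(1) L] by simp
next
  case False
  then show ?thesis by (simp add: partial1_def vector_derivative_undefined)
qed

text \<open>The integrand of \<open>xi\<close>, extended by zero so that substitutions can be made
  in integrals over the whole plane.\<close>

definition sq_density :: "(real \<Rightarrow> real \<Rightarrow> real) \<Rightarrow> real \<times> real \<Rightarrow> real" where
  "sq_density C p = indicator ({0..1} \<times> {0..1}) p * (partial1 C (fst p) (snd p))\<^sup>2"

lemma xi_eq: "xi C = 6 * integral\<^sup>L lborel (sq_density C) - 2"
  by (simp add: xi_def set_lebesgue_integral_def sq_density_def[abs_def] case_prod_unfold)

lemma copula_integrable_sq_density:
  assumes C: "copula C"
  shows "integrable lborel (sq_density C)"
proof (rule Bochner_Integration.integrable_bound)
  let ?K = "(max 1 \<bar>SOME L. False\<bar>)\<^sup>2 :: real"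
  have "emeasure lborel ({0..1} \<times> {0..1} :: (real \<times> real) set) < \<infinity>"
    using emeasure_lborel_cbox_finite[of "(0, 0) :: real \<times> real" "(1, 1)"]
    by (simp add: cbox_Pair_eq)
  then show "integrable lborel (\<lambda>p :: real \<times> real. indicator ({0..1} \<times> {0..1}) p * ?K)"
    by (intro integrable_mult_left integrable_real_indicator) (auto intro: borel_closed closed_Times)
  show "sq_density C \<in> borel_measurable lborel"
    unfolding sq_density_def[abs_def] measurable_lborel2
    \<comment> \<open>Clipping both arguments provides the continuous extension to the
      plane.\<close>
    by (rule partial1_measurable[of "\<lambda>u v. C (clip u) (clip v)"])
       (use C in \<open>auto intro!: continuous_intros\<close>)
  show "AE p in lborel. norm (sq_density C p) \<le> norm (indicator ({0..1} \<times> {0..1}) p * ?K)"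
    using power_mono[OF copula_partial1_bound[OF C], of _ _ 2]
    by (intro always_eventually) (auto simp: sq_density_def indicator_def)
qed

section \<open>The ordinal sum as \<open>min\<close> plus one correction per square\<close>

lemma ordinal_sum_outside:
  assumes "\<And>k. k \<in> {1..n} \<Longrightarrow> \<not> (u \<in> {a k..b k} \<and> v \<in> {a k..b k})"
  shows "ordinal_sum n a b Bs u v = min u v"
  using assms by (auto simp: ordinal_sum_def)

context
  fixes n :: nat and a b :: "nat \<Rightarrow> real" and Bs :: "nat \<Rightarrow> real \<Rightarrow> real \<Rightarrow> real"
  assumes ab: "\<And>k. k \<in> {1..n} \<Longrightarrow> 0 \<le> a k \<and> a k < b k \<and> b k \<le> 1"
    and disj: "disjoint_family_on (\<lambda>k. {a k<..<b k}) {1..n}"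
    and cop: "\<And>k. k \<in> {1..n} \<Longrightarrow> copula (Bs k)"
begin

text \<open>The action of the affine map \<open>T\<^sub>k\<close> on each coordinate.\<close>

definition unscale :: "nat \<Rightarrow> real \<Rightarrow> real" where
  "unscale k x = (x - a k) / (b k - a k)"

lemma unscale_in_iff: "k \<in> {1..n} \<Longrightarrow> unscale k x \<in> {0..1} \<longleftrightarrow> x \<in> {a k..b k}"
  using ab[of k] by (auto simp: unscale_def divide_simps)

lemma unscale_le_0: "k \<in> {1..n} \<Longrightarrow> x \<le> a k \<Longrightarrow> unscale k x \<le> 0"
  and unscale_ge_1: "k \<in> {1..n} \<Longrightarrow> b k \<le> x \<Longrightarrow> 1 \<le> unscale k x"
  using ab[of k] by (auto simp: unscale_def divide_simps)

lemma unscale_less_iff: "k \<in> {1..n} \<Longrightarrow> unscale k x < unscale k y \<longleftrightarrow> x < y"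
  using ab[of k] by (auto simp: unscale_def divide_simps)

text \<open>Otherwise a point strictly between the larger left end and the smaller right end would
  lie in both open intervals.\<close>

lemma intervals_separated:
  assumes "k \<in> {1..n}" "j \<in> {1..n}" "k \<noteq> j"
  shows "b j \<le> a k \<or> b k \<le> a j"
proof -
  have "{a j<..<b j} \<inter> {a k<..<b k} = {}"
    using disj assms by (auto simp: disjoint_family_on_def)
  then have "\<not> max (a j) (a k) < min (b j) (b k)"
    using dense[of "max (a j) (a k)" "min (b j) (b k)"] by fastforce
  then show ?thesis using ab[of j] ab[of k] assms by auto
qed

definition bump :: "nat \<Rightarrow> real \<Rightarrow> real \<Rightarrow> real" where
  "bump k u v = (b k - a k) *
    (Bs k (clip (unscale k u)) (clip (unscale k v)) - min (clip (unscale k u)) (clip (unscale k v)))"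

text \<open>
  A copula agrees with \<^const>\<open>min\<close> on the boundary of the unit square, so clipping extends the
  difference of the two continuously by zero.
\<close>

lemma bump_outside:
  assumes k: "k \<in> {1..n}" and uv: "u \<notin> {a k<..<b k} \<or> v \<notin> {a k<..<b k}"
  shows "bump k u v = 0"
proof -
  have "clip (unscale k u) \<in> {0, 1} \<or> clip (unscale k v) \<in> {0, 1}"
    using uv unscale_le_0[OF k] unscale_ge_1[OF k] by (auto simp: clip_outside not_less)
  moreover have "Bs k 0 y = 0" "Bs k y 0 = 0" "Bs k 1 y = y" "Bs k y 1 = y" if "y \<in> {0..1}" for y
    using cop[OF k] that by (auto simp: copula_def)
  ultimately show ?thesis by (auto simp: bump_def min_absorb1 min_absorb2)
qed

text \<open>Replaces the case distinction by a sum of functions continuous on the plane. Within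
  square \<open>k\<close> all other bumps vanish, and rescaling turns the subtracted minimum into
  \<open>min u v - a k\<close>.\<close>

lemma ordinal_sum_eq_min_plus_bumps:
  "ordinal_sum n a b Bs u v = min u v + (\<Sum>k=1..n. bump k u v)"
proof (cases "\<exists>k\<in>{1..n}. u \<in> {a k..b k} \<and> v \<in> {a k..b k}")
  case True
  then obtain k where k: "k \<in> {1..n}" and u: "u \<in> {a k..b k}" and v: "v \<in> {a k..b k}" by blast
  have "bump j u v = 0" if j: "j \<in> {1..n}" "j \<noteq> k" for j
    using bump_outside[OF j(1), of u v] intervals_separated[OF k j(1)] j u by auto
  then have "(\<Sum>k=1..n. bump k u v) = bump k u v"
    using k by (subst sum.remove[of _ k]) auto
  also have "\<dots> = ordinal_sum n a b Bs u v - min u v"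
  proof -
    have c: "b k - a k > 0" using ab[OF k] by simp
    have "(b k - a k) * min (unscale k u) (unscale k v) = min u v - a k"
      using c unscale_less_iff[OF k, of v u] by (cases "v < u") (simp_all add: min_def unscale_def)
    moreover have "ordinal_sum n a b Bs u v = a k + (b k - a k) * Bs k (unscale k u) (unscale k v)"
      unfolding unscale_def
      by (rule ordinal_sum_inside[where Bs = Bs, OF _ disj cop k u v]) (use ab in auto)
    moreover have "clip (unscale k u) = unscale k u" "clip (unscale k v) = unscale k v"
      using u v unscale_in_iff[OF k] by (blast intro: clip_id)+
    ultimately show ?thesis
      by (simp add: bump_def right_diff_distrib)
  qed
  finally show ?thesis by simp
next
  case False
  then have "(\<Sum>k=1..n. bump k u v) = 0"
    by (intro sum.neutral ballI bump_outside)
      (assumption, metis atLeastAtMost_iff greaterThanLessThan_iff less_imp_le)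
  then show ?thesis using False by (subst ordinal_sum_outside) auto
qed

text \<open>By the preceding representation the ordinal sum is continuous on the whole plane and can
  serve as its own extension \<open>F\<close>.\<close>

lemma sq_density_ordinal_sum_measurable:
  "sq_density (ordinal_sum n a b Bs) \<in> borel_measurable borel"
  unfolding sq_density_def[abs_def]
proof (rule partial1_measurable[where F = "ordinal_sum n a b Bs"])
  show "continuous_on UNIV (\<lambda>p. ordinal_sum n a b Bs (fst p) (snd p))"
    unfolding ordinal_sum_eq_min_plus_bumps bump_def unscale_def
    by (intro continuous_intros cop) (use ab in force)+
qed simp

section \<open>The partial derivative of the ordinal sum\<close>

text \<open>In the chain rule the outer factor \<open>b k - a k\<close> cancels the inner one;
  composing with the inverse map gives the converse. The equivalence also transfers
  non-differentiability.\<close>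

lemma has_vector_derivative_unscale_iff:
  assumes k: "k \<in> {1..n}"
  shows "((\<lambda>s. a k + (b k - a k) * f (unscale k s)) has_vector_derivative L) (at u) \<longleftrightarrow>
    (f has_vector_derivative L) (at (unscale k u))"
proof -
  define c where "c = b k - a k"
  have c: "c > 0" using ab[OF k] by (simp add: c_def)
  have inv: "a k + c * unscale k u = u" "unscale k (a k + c * t) = t" for t
    using c by (simp_all add: unscale_def c_def)
  have "((\<lambda>s. a k + c * f (unscale k s)) has_real_derivative L) (at u)"
    if "(f has_real_derivative L) (at (unscale k u))"
  proof -
    have "(unscale k has_real_derivative 1 / c) (at u)"
      unfolding unscale_def[abs_def] c_def[symmetric] using c by (auto intro!: derivative_eq_intros)
    from DERIV_chain2[OF that this] show ?thesis
      using c by (auto intro!: derivative_eq_intros)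
  qed
  moreover have "(f has_real_derivative L) (at (unscale k u))"
    if "((\<lambda>s. a k + c * f (unscale k s)) has_real_derivative L) (at u)"
  proof -
    have "((\<lambda>t. a k + c * t) has_real_derivative c) (at (unscale k u))"
      by (auto intro!: derivative_eq_intros)
    with that have "((\<lambda>t. a k + c * f (unscale k (a k + c * t))) has_real_derivative L * c)
        (at (unscale k u))"
      by (intro DERIV_chain2[where f = "\<lambda>s. a k + c * f (unscale k s)"]) (simp_all add: inv)
    then have "((\<lambda>t. (a k + c * f t - a k) / c) has_real_derivative (L * c - 0) / c)
        (at (unscale k u))"
      unfolding inv by (intro DERIV_cdivide DERIV_diff DERIV_const)
    then show ?thesis using c by simp
  qed
  ultimately show ?thesis
    by (auto simp: has_real_derivative_iff_has_vector_derivative c_def)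
qed

lemma partial1_ordinal_sum_inside:
  assumes k: "k \<in> {1..n}" and u: "u \<in> {a k<..<b k}" and v: "v \<in> {a k..b k}"
  shows "partial1 (ordinal_sum n a b Bs) u v = partial1 (Bs k) (unscale k u) (unscale k v)"
proof -
  have T: "unscale k u \<in> {0<..<1}"
    using u ab[OF k] by (auto simp: unscale_def divide_simps)
  \<comment> \<open>Both points are interior, so the derivatives relative to the unit interval are
    ordinary two-sided ones.\<close>
  have at: "at u within {0..1} = at u" "at (unscale k u) within {0..1} = at (unscale k u)"
    using u T ab[OF k] by (auto intro!: at_within_interior)
  have "eventually (\<lambda>s. s \<in> {a k<..<b k}) (nhds u)"
    using u by (intro eventually_nhds_in_open) auto
  then have "eventually (\<lambda>s. ordinal_sum n a b Bs s v =
      a k + (b k - a k) * Bs k (unscale k s) (unscale k v)) (nhds u)"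
    unfolding unscale_def
    by eventually_elim (use ordinal_sum_inside[OF _ disj cop k _ v] ab in auto)
  then have "vector_derivative (\<lambda>s. ordinal_sum n a b Bs s v) (at u) =
      vector_derivative (\<lambda>s. a k + (b k - a k) * Bs k (unscale k s) (unscale k v)) (at u)"
    by (intro vector_derivative_cong_eq) auto
  \<comment> \<open>The same numbers qualify as derivative on both sides, so the choice operator
    returns the same value even if there are none.\<close>
  also have "\<dots> = vector_derivative (\<lambda>s. Bs k s (unscale k v)) (at (unscale k u))"
    unfolding vector_derivative_def
    using has_vector_derivative_unscale_iff[OF k, of "\<lambda>s. Bs k s (unscale k v)"] by simp
  finally show ?thesis by (simp add: partial1_def at)
qed

text \<open>The squares are closed and \<open>u \<noteq> v\<close>, so for \<open>s\<close> near
  \<open>u\<close> the point \<open>(s, v)\<close> stays outside all squares and on the same side of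
  the diagonal. There the function is either \<open>s\<close> or the constant
  \<open>v\<close>.\<close>

lemma partial1_ordinal_sum_outside:
  assumes out: "\<And>k. k \<in> {1..n} \<Longrightarrow> \<not> (u \<in> {a k..b k} \<and> v \<in> {a k..b k})"
    and u: "u \<in> {0..1}" and neq: "u \<noteq> v"
  shows "partial1 (ordinal_sum n a b Bs) u v = of_bool (u < v)"
proof -
  have "open (\<Inter>k\<in>{1..n}. {s. \<not> (s \<in> {a k..b k} \<and> v \<in> {a k..b k})})" (is "open ?O")
  proof (intro open_INT ballI)
    show "open {s. \<not> (s \<in> {a k..b k} \<and> v \<in> {a k..b k})}" for k
    proof (cases "v \<in> {a k..b k}")
      case True
      then have "{s. \<not> (s \<in> {a k..b k} \<and> v \<in> {a k..b k})} = - {a k..b k}" by auto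
      then show ?thesis by (simp add: open_Compl)
    next
      case False
      then have "{s. \<not> (s \<in> {a k..b k} \<and> v \<in> {a k..b k})} = UNIV" by auto
      then show ?thesis by simp
    qed
  qed simp
  moreover have "u \<in> ?O" using out by auto
  ultimately have "eventually (\<lambda>s. s \<in> ?O) (nhds u)" by (rule eventually_nhds_in_open)
  moreover have "eventually (\<lambda>s. s \<in> (if u < v then {..<v} else {v<..})) (nhds u)"
    using neq by (intro eventually_nhds_in_open) auto
  ultimately have ev: "eventually (\<lambda>s. ordinal_sum n a b Bs s v = (if u < v then s else v)) (nhds u)"
    by eventually_elim (subst ordinal_sum_outside, auto split: if_splits)
  show ?thesis
  proof (rule partial1_eqI[OF u])
    have "((\<lambda>s. if u < v then s else v) has_vector_derivative of_bool (u < v)) (at u within {0..1})"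
      by (auto intro!: derivative_eq_intros)
    then show "((\<lambda>s. ordinal_sum n a b Bs s v) has_vector_derivative of_bool (u < v)) (at u within {0..1})"
      using ev eventually_nhds_x_imp_x[OF ev]
      by (subst has_vector_derivative_cong_ev[where g = "\<lambda>s. if u < v then s else v"])
         (auto elim: eventually_mono)
  qed
qed

section \<open>Integrating the deviation from \<open>min\<close>\<close>

definition excess :: "nat \<Rightarrow> real \<times> real \<Rightarrow> real" where
  "excess k p = sq_density (Bs k) p - indicator triangle p"

lemma excess_zero: "p \<notin> {0..1} \<times> {0..1} \<Longrightarrow> excess k p = 0"
  by (cases p) (auto simp: excess_def sq_density_def triangle_def)

text \<open>Solving the definition of \<open>xi\<close> for the integral gives
  \<open>(xi (Bs k) + 2) / 6\<close>, from which the area 1/2 of the triangle is subtracted.\<close>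

lemma has_bochner_integral_excess:
  assumes "k \<in> {1..n}"
  shows "has_bochner_integral lborel (excess k) ((xi (Bs k) - 1) / 6)"
proof -
  have "has_bochner_integral lborel (sq_density (Bs k)) ((xi (Bs k) + 2) / 6)"
    using copula_integrable_sq_density[OF cop[OF assms]]
    by (simp add: has_bochner_integral_iff xi_eq)
  from has_bochner_integral_diff[OF this has_bochner_integral_triangle]
  have "has_bochner_integral lborel (excess k) ((xi (Bs k) + 2) / 6 - 1 / 2)"
    unfolding excess_def[abs_def] .
  moreover have "(xi (Bs k) + 2) / 6 - 1 / 2 = (xi (Bs k) - 1) / 6"
    by (simp add: field_simps)
  ultimately show ?thesis by simp
qed

text \<open>Inside square \<open>k\<close> only the \<open>k\<close>-th excess survives, and its
  triangle term cancels the global one because rescaling preserves \<open>u < v\<close>. Outside all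
  squares every excess vanishes. Excluding endpoints as values of \<open>u\<close> leaves no
  vertical edge between these cases.\<close>

lemma sq_density_ordinal_sum:
  assumes neq: "u \<noteq> v" and ends: "\<And>k. k \<in> {1..n} \<Longrightarrow> u \<noteq> a k \<and> u \<noteq> b k"
  shows "sq_density (ordinal_sum n a b Bs) (u, v) =
    indicator triangle (u, v) + (\<Sum>k=1..n. excess k (unscale k u, unscale k v))"
proof (cases "\<exists>k\<in>{1..n}. u \<in> {a k<..<b k} \<and> v \<in> {a k..b k}")
  case True
  then obtain k where k: "k \<in> {1..n}" and u: "u \<in> {a k<..<b k}" and v: "v \<in> {a k..b k}" by blast
  have "excess j (unscale j u, unscale j v) = 0" if j: "j \<in> {1..n}" "j \<noteq> k" for j
  proof (rule excess_zero)
    have "u \<notin> {a j..b j}" using intervals_separated[OF k j(1)] j u by auto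
    then show "(unscale j u, unscale j v) \<notin> {0..1} \<times> {0..1}"
      using unscale_in_iff[OF j(1)] by blast
  qed
  then have "(\<Sum>k=1..n. excess k (unscale k u, unscale k v)) = excess k (unscale k u, unscale k v)"
    using k by (subst sum.remove[of _ k]) auto
  moreover have "unscale k u \<in> {0..1}" "unscale k v \<in> {0..1}"
    using k u v unscale_in_iff by auto
  moreover have "u \<in> {0..1}" "v \<in> {0..1}"
    using u v ab[OF k] by auto
  ultimately show ?thesis
    using unscale_less_iff[OF k, of u v] partial1_ordinal_sum_inside[OF k u v]
    by (simp add: excess_def sq_density_def triangle_def indicator_def)
next
  case False
  then have out: "\<not> (u \<in> {a k..b k} \<and> v \<in> {a k..b k})" if "k \<in> {1..n}" for k
    using that ends[OF that] by force
  then have "(\<Sum>k=1..n. excess k (unscale k u, unscale k v)) = 0"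
    by (intro sum.neutral ballI excess_zero) (auto simp: unscale_in_iff simp del: atLeastAtMost_iff)
  then show ?thesis
    using partial1_ordinal_sum_outside[OF out _ neq]
    by (auto simp: sq_density_def triangle_def indicator_def)
qed

lemma xi_ordinal_sum:
  "xi (ordinal_sum n a b Bs) = 1 - (\<Sum>k=1..n. (b k - a k)\<^sup>2 * (1 - xi (Bs k)))"
proof -
  let ?g = "\<lambda>p. indicator triangle p +
      (\<Sum>k=1..n. excess k ((p - (a k, a k)) /\<^sub>R (b k - a k)))"
  have g: "has_bochner_integral lborel ?g
      (1 / 2 + (\<Sum>k=1..n. (b k - a k)\<^sup>2 * ((xi (Bs k) - 1) / 6)))"
  proof (intro has_bochner_integral_add has_bochner_integral_sum has_bochner_integral_triangle)
    fix k assume k: "k \<in> {1..n}"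
    show "has_bochner_integral lborel (\<lambda>p. excess k ((p - (a k, a k)) /\<^sub>R (b k - a k)))
        ((b k - a k)\<^sup>2 * ((xi (Bs k) - 1) / 6))"
      \<comment> \<open>The plane has dimension 2, whence the square of the interval length.\<close>
      using affine_change_of_variables_lborel[of "excess k" "b k - a k" "(a k, a k)"]
        has_bochner_integral_excess[OF k] ab[OF k]
      by (simp add: has_bochner_integral_iff power2_eq_square)
  qed
  \<comment> \<open>The normal \<open>(1, -1)\<close> describes the diagonal; \<open>(1, 0)\<close>
    describes the vertical lines through the interval endpoints.\<close>
  have "AE p in lborel. (1, - 1 :: real) \<bullet> p \<noteq> 0"
    by (rule AE_lborel_hyperplane) (simp add: zero_prod_def)
  moreover have "AE p in lborel. \<forall>k\<in>{1..n}.
      (1 :: real, 0 :: real) \<bullet> p \<noteq> a k \<and> (1 :: real, 0 :: real) \<bullet> p \<noteq> b k"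
    by (intro AE_finite_allI AE_conjI AE_lborel_hyperplane) (simp_all add: zero_prod_def)
  ultimately have "AE p in lborel. sq_density (ordinal_sum n a b Bs) p = ?g p"
  proof eventually_elim
    case (elim p)
    obtain u v where [simp]: "p = (u, v)" by (cases p)
    have "(p - (a k, a k)) /\<^sub>R (b k - a k) = (unscale k u, unscale k v)" for k
      by (simp add: unscale_def divide_inverse mult.commute)
    then show ?case using elim sq_density_ordinal_sum[of u v] by simp
  qed
  \<comment> \<open>For equal integrals of functions that agree almost everywhere, measurability of
    both suffices.\<close>
  then have "integral\<^sup>L lborel (sq_density (ordinal_sum n a b Bs)) = integral\<^sup>L lborel ?g"
    using sq_density_ordinal_sum_measurable borel_measurable_has_bochner_integral[OF g]
    by (intro integral_cong_AE) auto
  also have "\<dots> = 1 / 2 + (\<Sum>k=1..n. (b k - a k)\<^sup>2 * ((xi (Bs k) - 1) / 6))"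
    using g by (simp add: has_bochner_integral_iff)
  finally have "xi (ordinal_sum n a b Bs) = 1 + 6 * (\<Sum>k=1..n. (b k - a k)\<^sup>2 * ((xi (Bs k) - 1) / 6))"
    by (simp add: xi_eq)
  also have "\<dots> = 1 - (\<Sum>k=1..n. (b k - a k)\<^sup>2 * (1 - xi (Bs k)))"
  proof -
    have "6 * (\<Sum>k=1..n. (b k - a k)\<^sup>2 * ((xi (Bs k) - 1) / 6))
        = (\<Sum>k=1..n. - ((b k - a k)\<^sup>2 * (1 - xi (Bs k))))"
      unfolding sum_distrib_left by (intro sum.cong refl) (simp add: field_simps)
    then show ?thesis by (simp add: sum_negf)
  qed
  finally show ?thesis .
qed

end

theorem proposition3p7:
  fixes n :: nat and a b :: "nat \<Rightarrow> real" and Bs :: "nat \<Rightarrow> real \<Rightarrow> real \<Rightarrow> real"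
  assumes "\<And>k. k \<in> {1..n} \<Longrightarrow> 0 \<le> a k \<and> a k < b k \<and> b k \<le> 1"
    and "disjoint_family_on (\<lambda>k. {a k<..<b k}) {1..n}"
    and "\<And>k. k \<in> {1..n} \<Longrightarrow> copula (Bs k)"
  shows "xi (ordinal_sum n a b Bs) = 1 - (\<Sum>k=1..n. (b k - a k)\<^sup>2 * (1 - xi (Bs k)))"
  using assms by (rule xi_ordinal_sum)

end
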